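(* Let $n\ge 1$ and let $G$ be a finitely generated abelian sub-semigroup of $M_n(\mathbb{C})$, generated by $A_1,\dots,A_p$ ($p\ge 1$). Let $P\in \mathrm{GL}(n,\mathbb{C})$, $r\in\{1,\dots,n\}$ and $\eta=(n_1,\dots,n_r)$ be a sequence of positive integers with $n_1+\dots+n_r=n$ such that $P^{-1}GP\subset \mathcal{K}_{\eta,r}(\mathbb{C})$, and let $V=P(U)$, where $U=\prod_{k=1}^{r}(\mathbb{C}^*\times\mathbb{C}^{n_k-1})$. If $J_G(v)=\mathbb{C}^n$ for some $v\in V$, then $\overline{G(v)}=\mathbb{C}^n$.
   Context: $M_n(\mathbb{C})$ is the set of $n\times n$ complex matrices. $\mathbb{N}$ contains $0$. The abelian semigroup $G$ generated by pairwise commuting matrices $A_1,\dots,A_p$ is the set of products $A_1^{k_1}\cdots A_p^{k_p}$ with $k_j$ non-negative integers. The orbit of $v\in\mathbb{C}^n$ is $G(v)=\{Av: A\in G\}$, and $\overline{E}$ is the closure of $E\subset\mathbb{C}^n$. Extended limit set: for $x\in\mathbb{C}^n$, $J_G(x)$ is the set of $y\in\mathbb{C}^n$ for which there exist a sequence $(x_m)_m\subset\mathbb{C}^n$ and sequences of non-negative integers $(k_m^{(j)})_m$, $j=1,\dots,p$, with $k_m^{(1)}+\dots+k_m^{(p)}\to+\infty$, such that $x_m\to x$ and $A_1^{k_m^{(1)}}\cdots A_p^{k_m^{(p)}}x_m\to y$. $\mathbb{T}_m(\mathbb{C})$ is the set of $m\times m$ complex lower triangular matrices whose diagonal entries are all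 equal. For positive integers $n_1,\dots,n_r$ with sum $n$ and $\eta=(n_1,\dots,n_r)$, $\mathcal{K}_{\eta,r}(\mathbb{C})=\mathbb{T}_{n_1}(\mathbb{C})\oplus\dots\oplus\mathbb{T}_{n_r}(\mathbb{C})$ is the set of block diagonal matrices $\mathrm{diag}(B_1,\dots,B_r)$ with $B_k\in\mathbb{T}_{n_k}(\mathbb{C})$. It is a known fact that for every abelian sub-semigroup $G$ of $M_n(\mathbb{C})$ there exist such $P,\eta,r$. $\mathbb{C}^n$ is identified with $\prod_k\mathbb{C}^{n_k}$. *)

theory Defs
  imports "HOL-Analysis.Analysis"
begin

text \<open>
  The library operations \<open>*\<close> and \<open>^\<close> on the vector type are entrywise, so powers with
  respect to the matrix product \<open>**\<close> are introduced separately.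
\<close>

primrec mat_power :: "complex ^ 'n ^ 'n \<Rightarrow> nat \<Rightarrow> complex ^ 'n ^ 'n" where
  "mat_power M 0 = mat 1"
| "mat_power M (Suc k) = M ** mat_power M k"

text \<open>\<open>monomial_mat A k p\<close> is the product \<open>A 1 ^ k 1 ** \<dots> ** A p ^ k p\<close>.\<close>

primrec monomial_mat ::
  "(nat \<Rightarrow> complex ^ 'n ^ 'n) \<Rightarrow> (nat \<Rightarrow> nat) \<Rightarrow> nat \<Rightarrow> complex ^ 'n ^ 'n" where
  "monomial_mat A k 0 = mat 1"
| "monomial_mat A k (Suc p) = monomial_mat A k p ** mat_power (A (Suc p)) (k (Suc p))"

definition semigroup_gen :: "(nat \<Rightarrow> complex ^ 'n ^ 'n) \<Rightarrow> nat \<Rightarrow> (complex ^ 'n ^ 'n) set" where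
  "semigroup_gen A p = {monomial_mat A k p | k. True}"

definition orbit :: "(complex ^ 'n ^ 'n) set \<Rightarrow> complex ^ 'n \<Rightarrow> (complex ^ 'n) set" where
  "orbit G v = {M *v v | M. M \<in> G}"

text \<open>
  The extended limit set is defined through exponent sequences, hence from the
  generators \<open>A 1, \<dots>, A p\<close>; \<open>k m j\<close> is the exponent of \<open>A j\<close> in the \<open>m\<close>-th word.
\<close>

definition J_set ::
  "(nat \<Rightarrow> complex ^ 'n ^ 'n) \<Rightarrow> nat \<Rightarrow> complex ^ 'n \<Rightarrow> (complex ^ 'n) set" where
  "J_set A p x = {y. \<exists>(xs :: nat \<Rightarrow> complex ^ 'n) (k :: nat \<Rightarrow> nat \<Rightarrow> nat).
      filterlim (\<lambda>m. \<Sum>j\<in>{1..p}. k m j) at_top sequentially \<and>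
      xs \<longlonglongrightarrow> x \<and>
      (\<lambda>m. monomial_mat A (k m) p *v xs m) \<longlonglongrightarrow> y}"

text \<open>
  The index type is finite and linearly ordered, hence order isomorphic to
  \<open>{1..CARD('n)}\<close> in exactly one way; \<open>pos i\<close> is the number of the index \<open>i\<close>.
\<close>

definition pos :: "'n :: {finite, linorder} \<Rightarrow> nat" where
  "pos i = card {..i}"

text \<open>
  For block sizes \<open>\<eta> 1, \<eta> 2, \<dots>\<close>, the \<open>k\<close>-th block (\<open>k \<ge> 1\<close>) occupies the positions
  \<open>\<eta> 1 + \<dots> + \<eta> (k - 1) + 1, \<dots>, \<eta> 1 + \<dots> + \<eta> k\<close>.
\<close>

definition block :: "(nat \<Rightarrow> nat) \<Rightarrow> nat \<Rightarrow> ('n :: {finite, linorder}) set" where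
  "block \<eta> k = {i. (\<Sum>l\<in>{1..<k}. \<eta> l) < pos i \<and> pos i \<le> (\<Sum>l\<in>{1..k}. \<eta> l)}"

text \<open>
  The submatrix of \<open>M\<close> with rows and columns in \<open>I\<close> is lower triangular with all its
  diagonal entries equal.
\<close>

definition lower_tri_const_diag_on ::
  "('n :: {finite, linorder}) set \<Rightarrow> complex ^ 'n :: {finite, linorder} ^ 'n :: {finite, linorder} \<Rightarrow> bool" where
  "lower_tri_const_diag_on I M \<longleftrightarrow>
     (\<forall>i\<in>I. \<forall>j\<in>I. i < j \<longrightarrow> M $ i $ j = 0) \<and>
     (\<forall>i\<in>I. \<forall>j\<in>I. M $ i $ i = M $ j $ j)"

definition K_set :: "(nat \<Rightarrow> nat) \<Rightarrow> nat \<Rightarrow> (complex ^ 'n :: {finite, linorder} ^ 'n :: {finite, linorder}) set" where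
  "K_set \<eta> r = {M.
     (\<forall>k\<in>{1..r}. lower_tri_const_diag_on (block \<eta> k) M) \<and>
     (\<forall>k\<in>{1..r}. \<forall>l\<in>{1..r}. k \<noteq> l \<longrightarrow>
        (\<forall>i\<in>block \<eta> k. \<forall>j\<in>block \<eta> l. M $ i $ j = 0))}"

text \<open>
  The product of the sets \<open>(\<complex> - {0}) \<times> \<complex> ^ (\<eta> k - 1)\<close>: the coordinate at the first
  position of each block is nonzero.
\<close>

definition U_set :: "(nat \<Rightarrow> nat) \<Rightarrow> nat \<Rightarrow> (complex ^ 'n :: {finite, linorder}) set" where
  "U_set \<eta> r = {x. \<forall>k\<in>{1..r}. \<forall>i.
      pos i = Suc (\<Sum>l\<in>{1..<k}. \<eta> l) \<longrightarrow> x $ i \<noteq> 0}"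

end

theory Submission
  imports Defs
begin

text \<open>
  Conjugate so that \<open>P = 1\<close>. If every vector is \<open>T v\<close> for some \<open>T\<close> in the commutant of \<open>G\<close>, then
  \<open>x\<^sub>m = T\<^sub>m v\<close> with \<open>T\<^sub>m \<longrightarrow> 1\<close> commuting with \<open>G\<close>, so \<open>M\<^sub>m x\<^sub>m = T\<^sub>m M\<^sub>m v\<close> and \<open>M\<^sub>m v\<close> has the same limit
  as \<open>M\<^sub>m x\<^sub>m\<close>. Otherwise the linear forms vanishing on the vectors \<open>T v\<close> are a nonzero
  \<open>G\<close>-invariant space, which by triangularity contains a common eigenform \<open>f\<close> whose character
  \<open>\<lambda>\<close> is the diagonal of some block \<open>k\<close>. The first coordinate \<open>g\<close> of block \<open>k\<close> is an
  eigenform for the same \<open>\<lambda>\<close>, and \<open>g(v) \<noteq> 0 = f(v)\<close>. Since \<open>\<lambda>(M\<^sub>m) g(x\<^sub>m)\<close> converges, so does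
  \<open>\<lambda>(M\<^sub>m)\<close>, hence \<open>\<lambda>(M\<^sub>m) f(x\<^sub>m)\<close> tends to \<open>0\<close>: the form \<open>f\<close> vanishes on the extended limit set,
  which is everything, a contradiction.
\<close>

section \<open>Linear forms and the bilinear pairing\<close>

text \<open>Bilinear, without conjugation: \<open>dot f\<close> is complex linear, and
  \<open>f v* M\<close> is the pullback of the form \<open>f\<close> along \<open>M\<close>.\<close>

definition dot :: "complex ^ 'n \<Rightarrow> complex ^ 'n \<Rightarrow> complex" where
  "dot f x = (\<Sum>i\<in>UNIV. f $ i * x $ i)"

lemma dot_vector_matrix_mult: "dot (f v* M) x = dot f (M *v x)"
proof -
  have "dot (f v* M) x = (\<Sum>j\<in>UNIV. \<Sum>i\<in>UNIV. f $ i * M $ i $ j * x $ j)"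
    by (simp add: dot_def vector_matrix_mult_def sum_distrib_right)
  also have "\<dots> = (\<Sum>i\<in>UNIV. \<Sum>j\<in>UNIV. f $ i * M $ i $ j * x $ j)"
    by (rule sum.swap)
  also have "\<dots> = dot f (M *v x)"
    by (simp add: dot_def matrix_vector_mult_def sum_distrib_left mult.assoc)
  finally show ?thesis .
qed

lemma dot_smult_left: "dot (c *s f) x = c * dot f x"
  by (simp add: dot_def sum_distrib_left mult.assoc)

lemma dot_axis: "dot f (axis i 1) = f $ i"
  by (simp add: dot_def axis_def if_distrib sum.delta cong: if_cong)

lemma tendsto_dot:
  assumes "x \<longlonglongrightarrow> y"
  shows "(\<lambda>m. dot f (x m)) \<longlonglongrightarrow> dot f y"
  unfolding dot_def using assms by (intro tendsto_intros)

text \<open>A real-orthogonal vector \<open>z\<close> gives the form with coefficients \<open>cnj z\<close>: stability of the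
  subspace under \<open>\<i>\<close> kills the imaginary part as well.\<close>

lemma exists_annihilating_form:
  fixes W :: "(complex ^ 'n) set"
  assumes W: "vec.subspace W" and "W \<noteq> UNIV"
  obtains f where "f \<noteq> 0" "\<And>w. w \<in> W \<Longrightarrow> dot f w = 0"
proof -
  have scaleR_eq: "c *\<^sub>R x = complex_of_real c *s x" for c :: real and x :: "complex ^ 'n"
    by (simp add: vec_eq_iff complex_eq_iff)
  have "subspace W"
    unfolding subspace_def scaleR_eq
    using vec.subspace_0[OF W] vec.subspace_add[OF W] vec.subspace_scale[OF W] by auto
  then have "span W = W"
    by (simp add: span_eq_iff)
  with span_not_UNIV_orthogonal[of W] \<open>W \<noteq> UNIV\<close>
  obtain z where z: "z \<noteq> 0" "\<And>w. w \<in> W \<Longrightarrow> z \<bullet> w = 0" by metis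
  define f :: "complex ^ 'n" where "f = (\<chi> i. cnj (z $ i))"
  have Re: "Re (dot f w) = z \<bullet> w" for w
    by (simp add: dot_def f_def inner_vec_def inner_complex_def)
  have Im: "Im (dot f w) = - Re (dot f (\<i> *s w))" for w
    by (simp add: dot_def f_def algebra_simps flip: sum_negf)
  have "dot f w = 0" if "w \<in> W" for w
    using Im[of w] Re z(2) that vec.subspace_scale[OF W that, of \<i>] by (simp add: complex_eq_iff)
  moreover have "f \<noteq> 0"
    using z(1) by (auto simp: f_def vec_eq_iff)
  ultimately show ?thesis using that by blast
qed

lemma norm_smult: "norm (c *s x) = norm c * norm x" for x :: "complex ^ 'n"
  by (simp add: norm_vec_def norm_mult L2_set_right_distrib)

section \<open>Positions, blocks and block triangular matrices\<close>

lemma pos_strict_mono: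
  assumes "i < j" shows "pos i < pos j"
  unfolding pos_def using assms
  by (intro psubset_card_mono) auto

lemma pos_less_iff: "pos i < pos j \<longleftrightarrow> i < j"
  using pos_strict_mono by (metis less_asym linorder_cases less_irrefl)

lemma range_pos: "range (pos :: 'n::{finite,linorder} \<Rightarrow> nat) = {1..CARD('n)}"
proof (rule card_subset_eq)
  have "inj (pos :: 'n \<Rightarrow> nat)"
    by (rule injI) (metis less_irrefl linorder_cases pos_less_iff)
  then show "card (range (pos :: 'n \<Rightarrow> nat)) = card {1..CARD('n)}"
    by (simp add: card_image)
  have "pos i \<noteq> 0" for i :: 'n
    by (auto simp: pos_def)
  moreover have "pos i \<le> CARD('n)" for i :: 'n
    by (simp add: pos_def card_mono)
  ultimately show "range (pos :: 'n \<Rightarrow> nat) \<subseteq> {1..CARD('n)}"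
    by (auto simp: Suc_le_eq)
qed simp

lemma exists_block:
  fixes i :: "'n::{finite,linorder}"
  assumes "(\<Sum>k\<in>{1..r}. \<eta> k) = CARD('n)"
  obtains k where "k \<in> {1..r}" "i \<in> block \<eta> k"
proof -
  have i: "pos i \<in> {1..CARD('n)}"
    using range_pos by blast
  \<comment> \<open>Positions start at \<open>1\<close> and the empty sum is \<open>0\<close>, so
    this least index is at least \<open>1\<close>; minimality at \<open>k - 1\<close> gives the
    lower bound in \<open>block\<close>.\<close>
  define k where "k = (LEAST k. pos i \<le> (\<Sum>l\<in>{1..k}. \<eta> l))"
  have r: "pos i \<le> (\<Sum>l\<in>{1..r}. \<eta> l)"
    using i assms by simp
  then have k: "pos i \<le> (\<Sum>l\<in>{1..k}. \<eta> l)" "k \<le> r"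
    unfolding k_def by (auto intro: LeastI Least_le)
  with i have "k \<noteq> 0" by (cases k) auto
  then have "k - 1 < k" by simp
  then have "\<not> pos i \<le> (\<Sum>l\<in>{1..k-1}. \<eta> l)"
    unfolding k_def by (rule not_less_Least)
  moreover have "{1..k-1} = {1..<k}" by auto
  ultimately have "(\<Sum>l\<in>{1..<k}. \<eta> l) < pos i" by (simp only: not_le)
  with k(1) have "i \<in> block \<eta> k" by (simp add: block_def)
  moreover have "k \<in> {1..r}" using k(2) \<open>k \<noteq> 0\<close> by simp
  ultimately show ?thesis by (rule that[rotated])
qed

text \<open>Positivity of \<open>\<eta> k\<close> puts the position just after the earlier blocks
  inside block \<open>k\<close>; \<open>range_pos\<close> turns it into an index.\<close>

lemma exists_block_first:
  assumes "\<forall>k\<in>{1..r}. \<eta> k \<ge> 1" "(\<Sum>k\<in>{1..r}. \<eta> k) = CARD('n)" "k \<in> {1..r}"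
  obtains i :: "'n::{finite,linorder}"
  where "pos i = Suc (\<Sum>l\<in>{1..<k}. \<eta> l)" "i \<in> block \<eta> k" "\<And>j. j \<in> block \<eta> k \<Longrightarrow> i \<le> j"
proof -
  have "Suc (\<Sum>l\<in>{1..<k}. \<eta> l) \<le> (\<Sum>l\<in>{1..k}. \<eta> l)"
  proof -
    have "{1..k} = insert k {1..<k}" using assms(3) by auto
    then show ?thesis using assms(1,3) by (simp add: Suc_le_eq)
  qed
  also have "\<dots> \<le> (\<Sum>l\<in>{1..r}. \<eta> l)"
    using assms(3) by (intro sum_mono2) auto
  finally have "Suc (\<Sum>l\<in>{1..<k}. \<eta> l) \<in> {1..CARD('n)}"
    using assms(2) by simp
  then obtain i :: 'n where i: "pos i = Suc (\<Sum>l\<in>{1..<k}. \<eta> l)"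
    by (metis (no_types, lifting) image_iff range_pos)
  show ?thesis
  proof (rule that[OF i])
    show "i \<in> block \<eta> k"
      using \<open>Suc _ \<le> (\<Sum>l\<in>{1..k}. \<eta> l)\<close> i by (simp add: block_def)
    show "i \<le> j" if j: "j \<in> block \<eta> k" for j
    proof -
      have "\<not> pos j < pos i" using j i by (simp add: block_def)
      then show ?thesis by (simp add: pos_less_iff)
    qed
  qed
qed

lemma K_set_nonzero_entry:
  assumes "M \<in> K_set \<eta> r" "k \<in> {1..r}" "l \<in> {1..r}" "i \<in> block \<eta> k" "j \<in> block \<eta> l" "M $ i $ j \<noteq> 0"
  shows "k = l \<and> j \<le> i"
proof
  show "k = l" using assms unfolding K_set_def by blast
  with assms show "j \<le> i"
    unfolding not_less[symmetric] K_set_def lower_tri_const_diag_on_def by blast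
qed

lemma K_set_diag:
  assumes "M \<in> K_set \<eta> r" "k \<in> {1..r}" "i \<in> block \<eta> k" "j \<in> block \<eta> k"
  shows "M $ i $ i = M $ j $ j"
  using assms unfolding K_set_def lower_tri_const_diag_on_def by blast

text \<open>A nonzero entry of row \<open>i\<close> lies in the same block and not to the right of
  the diagonal, which for the first row of a block leaves the diagonal alone. Thus the first
  coordinate of a block is an eigenform of every matrix in \<open>K_set \<eta> r\<close>.\<close>

lemma K_set_first_row:
  assumes r: "(\<Sum>k\<in>{1..r}. \<eta> k) = CARD('n)" and k: "k \<in> {1..r}"
    and i: "i \<in> block \<eta> k" "\<And>j. j \<in> block \<eta> k \<Longrightarrow> i \<le> j"
    and M: "M \<in> K_set \<eta> r"
  shows "(M *v x) $ i = M $ i $ i * x $ (i :: 'n::{finite,linorder})"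
proof -
  have "M $ i $ j = 0" if "j \<noteq> i" for j
  proof (rule ccontr)
    assume nz: "M $ i $ j \<noteq> 0"
    obtain l where l: "l \<in> {1..r}" "j \<in> block \<eta> l" by (rule exists_block[OF r])
    from K_set_nonzero_entry[OF M k l(1) i(1) l(2) nz] l i(2) that show False by force
  qed
  then have "(\<Sum>j\<in>UNIV. M $ i $ j * x $ j) = (\<Sum>j\<in>UNIV. if j = i then M $ i $ i * x $ i else 0)"
    by (intro sum.cong) auto
  then show ?thesis
    by (simp add: matrix_vector_mult_def)
qed

section \<open>Approximation through the commutant\<close>

text \<open>If \<open>T i\<close> commutes with \<open>G\<close> and sends \<open>v\<close> to the
  \<open>i\<close>-th unit vector, the combination of the \<open>T i\<close> with coefficients
  \<open>(xs m - v) $ i\<close> sends \<open>v\<close> to \<open>xs m - v\<close>. So the error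
  \<open>Ms m *v (xs m - v)\<close> is this operator, which tends to zero, applied to
  \<open>Ms m *v v\<close>.\<close>

lemma commutant_closure:
  fixes v :: "complex ^ 'n"
  assumes cyclic: "{T *v v | T. \<forall>M\<in>G. T ** M = M ** T} = UNIV"
    and Ms: "\<And>m. Ms m \<in> G" and xs: "xs \<longlonglongrightarrow> v" and lim: "(\<lambda>m. Ms m *v xs m) \<longlonglongrightarrow> y"
  shows "(\<lambda>m. Ms m *v v) \<longlonglongrightarrow> y"
proof -
  have "\<forall>i. \<exists>T. T *v v = axis i 1 \<and> (\<forall>M\<in>G. T ** M = M ** T)"
    using cyclic by (auto simp: set_eq_iff) metis
  then obtain T where T: "\<And>i. T i *v v = axis i 1" "\<And>i M. M \<in> G \<Longrightarrow> T i ** M = M ** T i"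
    by metis
  \<comment> \<open>An upper bound for the operator norm of that combination.\<close>
  define e where "e m = (\<Sum>i\<in>UNIV. norm ((xs m - v) $ i) * onorm ((*v) (T i)))" for m
  have "e \<longlonglongrightarrow> (\<Sum>i\<in>UNIV. norm ((v - v) $ i) * onorm ((*v) (T i)))"
    unfolding e_def using xs by (intro tendsto_intros)
  then have e: "e \<longlonglongrightarrow> 0" by simp
  define w z where "w m = Ms m *v v" and "z m = Ms m *v xs m" for m
  have diff: "norm (z m - w m) \<le> e m * norm (w m)" for m
  proof -
    have "Ms m *v axis i 1 = T i *v w m" for i
      using T(2)[OF Ms] by (simp add: w_def flip: T(1)) (simp add: matrix_vector_mul_assoc)
    moreover have "z m - w m = Ms m *v (\<Sum>i\<in>UNIV. (xs m - v) $ i *s axis i 1)"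
      unfolding basis_expansion by (simp add: z_def w_def algebra_simps)
    ultimately have "z m - w m = (\<Sum>i\<in>UNIV. (xs m - v) $ i *s (T i *v w m))"
      by (simp only: vec.sum vec.scale)
    also have "norm \<dots> \<le> (\<Sum>i\<in>UNIV. norm ((xs m - v) $ i) * (onorm ((*v) (T i)) * norm (w m)))"
      
      by (intro sum_norm_le) (simp only: norm_smult, intro mult_left_mono onorm; simp)
    finally show ?thesis
      by (simp add: e_def sum_distrib_right mult.assoc)
  qed
  \<comment> \<open>Nothing bounds \<open>w m\<close> in advance. Once \<open>e m < 1 / 2\<close>,
    the estimate \<open>diff\<close> gives \<open>norm (w m) \<le> 2 * norm (z m)\<close>, and
    \<open>z\<close> converges.\<close>
  have "\<forall>\<^sub>F m in sequentially. norm (z m - w m) \<le> 2 * e m * norm (z m)"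
  proof -
    have "\<forall>\<^sub>F m in sequentially. e m < 1 / 2"
      using e by (rule order_tendstoD) simp
    then show ?thesis
    proof eventually_elim
      case (elim m)
      have "0 \<le> e m"
        unfolding e_def by (intro sum_nonneg mult_nonneg_nonneg onorm_pos_le) auto
      have "norm (w m) \<le> norm (z m) + norm (z m - w m)"
        by (metis norm_minus_commute norm_triangle_sub)
      also have "\<dots> \<le> norm (z m) + 1 / 2 * norm (w m)"
        using diff[of m] mult_right_mono[of "e m" "1/2" "norm (w m)"] elim by simp
      finally have "e m * norm (w m) \<le> e m * (2 * norm (z m))"
        using \<open>0 \<le> e m\<close> by (intro mult_left_mono) auto
      with diff[of m] show ?case by simp
    qed
  qed
  moreover have "(\<lambda>m. 2 * e m * norm (z m)) \<longlonglongrightarrow> 2 * 0 * norm y"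
    using e lim unfolding z_def by (intro tendsto_intros)
  ultimately have "(\<lambda>m. z m - w m) \<longlonglongrightarrow> 0"
    by (intro Lim_null_comparison[of "\<lambda>m. z m - w m"]) simp_all
  from tendsto_diff[OF lim[folded z_def] this] show ?thesis
    by (simp add: w_def)
qed

section \<open>Common eigenforms\<close>

text \<open>The support of \<open>f\<close>, closed downwards inside each block. When the blocks
  cover all indices, a matrix in \<open>K_set \<eta> r\<close> acting on row vectors moves entries
  only to smaller or equal indices of the same block, so this set cannot grow, whereas the plain
  support can.\<close>

definition block_support :: "(nat \<Rightarrow> nat) \<Rightarrow> nat \<Rightarrow> complex ^ 'n::{finite,linorder} \<Rightarrow> 'n set" where
  "block_support \<eta> r f = {i. \<exists>k\<in>{1..r}. i \<in> block \<eta> k \<and> (\<exists>j\<in>block \<eta> k. i \<le> j \<and> f $ j \<noteq> 0)}"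

text \<open>Lower triangularity keeps the defect inside the old block support. At \<open>j\<close>,
  the last nonzero entry of \<open>f\<close> in block \<open>k\<close>, the constant diagonal
  cancels the only surviving term, so \<open>j\<close> drops out.\<close>

lemma block_support_eigen_defect:
  fixes f :: "complex ^ 'n::{finite,linorder}"
  assumes r: "(\<Sum>k\<in>{1..r}. \<eta> k) = CARD('n)" and M: "M \<in> K_set \<eta> r"
    and k: "k \<in> {1..r}" and j: "j \<in> block \<eta> k" "f $ j \<noteq> 0"
      and max: "\<And>i. i \<in> block \<eta> k \<Longrightarrow> f $ i \<noteq> 0 \<Longrightarrow> i \<le> j"
  shows "block_support \<eta> r (f v* M - (M $ j $ j) *s f) \<subset> block_support \<eta> r f"
proof -
  define h where "h = f v* M - (M $ j $ j) *s f"
  have h: "h $ i = (\<Sum>l\<in>UNIV. f $ l * M $ l $ i) - M $ j $ j * f $ i" for i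
    by (simp add: h_def vector_matrix_mult_def)
  have column: "\<exists>j'\<in>block \<eta> l. i \<le> j' \<and> f $ j' \<noteq> 0" if l: "l \<in> {1..r}" "i \<in> block \<eta> l" "h $ i \<noteq> 0" for i l
  proof (cases "f $ i = 0")
    case True
    with l(3) have "(\<Sum>j'\<in>UNIV. f $ j' * M $ j' $ i) \<noteq> 0" by (simp add: h)
    then obtain j' where nz: "f $ j' \<noteq> 0" "M $ j' $ i \<noteq> 0"
      by (elim sum.not_neutral_contains_not_neutral) (simp, blast)
    obtain l' where l': "l' \<in> {1..r}" "j' \<in> block \<eta> l'" by (rule exists_block[OF r])
    from K_set_nonzero_entry[OF M l'(1) l(1) l'(2) l(2) nz(2)] have "l' = l" "i \<le> j'" by simp_all
    with l'(2) nz(1) show ?thesis by (intro bexI[of _ j']) simp_all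
  qed (use l in auto)
  \<comment> \<open>In the sum for \<open>i\<close>, a nonzero term with \<open>l \<noteq> i\<close>
    would need \<open>i < l\<close> and \<open>l \<le> j\<close>, contrary to
    \<open>j \<le> i\<close>.\<close>
  have vanish: "h $ i = 0" if i: "i \<in> block \<eta> k" "j \<le> i" for i
  proof -
    have "f $ l * M $ l $ i = 0" if "l \<noteq> i" for l
    proof (rule ccontr)
      assume nz: "f $ l * M $ l $ i \<noteq> 0"
      obtain l' where l': "l' \<in> {1..r}" "l \<in> block \<eta> l'" by (rule exists_block[OF r])
      from K_set_nonzero_entry[OF M l'(1) k l'(2) i(1)] nz have "l' = k" "i \<le> l" by auto
      with max[of l] l' nz i that show False by auto
    qed
    then have "(\<Sum>l\<in>UNIV. f $ l * M $ l $ i) = (\<Sum>l\<in>UNIV. if l = i then f $ i * M $ i $ i else 0)"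
      by (intro sum.cong) auto
    then show ?thesis
      using K_set_diag[OF M k i(1) j(1)] by (simp add: h)
  qed
  have "j \<in> block_support \<eta> r f"
    using k j by (auto simp: block_support_def)
  moreover have "j \<notin> block_support \<eta> r h"
  proof
    assume "j \<in> block_support \<eta> r h"
    then obtain k' j' where k': "k' \<in> {1..r}" "j \<in> block \<eta> k'" "j' \<in> block \<eta> k'" "j \<le> j'" "h $ j' \<noteq> 0"
      by (auto simp: block_support_def)
    from column[OF k'(1,3,5)] obtain j'' where j'': "j'' \<in> block \<eta> k'" "j' \<le> j''" "f $ j'' \<noteq> 0"
      by blast
    \<comment> \<open>\<open>block_support\<close> yields some block containing \<open>j\<close>;
      disjointness of the blocks identifies it with block \<open>k\<close>.\<close>
    have "k' = k"
    proof (rule ccontr)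
      assume "k' \<noteq> k"
      have "block \<eta> a \<inter> block \<eta> b = ({} :: 'n set)" if "a < b" for a b
      proof -
        have "(\<Sum>l\<in>{1..a}. \<eta> l) \<le> (\<Sum>l\<in>{1..<b}. \<eta> l)"
          using that by (intro sum_mono2) auto
        then show ?thesis by (auto simp: block_def)
      qed
      with \<open>k' \<noteq> k\<close> k'(2) j(1) show False
        by (metis disjoint_iff linorder_neq_iff)
    qed
    with vanish[of j'] k' show False by simp
  qed
  moreover have "block_support \<eta> r h \<subseteq> block_support \<eta> r f"
    using column unfolding block_support_def by (blast intro: order_trans)
  ultimately show ?thesis unfolding h_def by blast
qed

text \<open>A nonzero form in the invariant space with smallest block support is an eigenform,
  because its eigen defect lies in the space and has smaller block support.\<close>

lemma exists_common_eigenform: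
  fixes N :: "(complex ^ 'n::{finite,linorder}) set"
  assumes r: "(\<Sum>k\<in>{1..r}. \<eta> k) = CARD('n)" and G: "G \<subseteq> K_set \<eta> r"
    and N: "vec.subspace N" "\<And>f M. f \<in> N \<Longrightarrow> M \<in> G \<Longrightarrow> f v* M \<in> N" and "N \<noteq> {0}"
  obtains f k j where "f \<in> N" "f \<noteq> 0" "k \<in> {1..r}" "j \<in> block \<eta> k"
    "\<And>M. M \<in> G \<Longrightarrow> f v* M = (M $ j $ j) *s f"
proof -
  obtain f0 where "f0 \<in> N" "f0 \<noteq> 0" using \<open>N \<noteq> {0}\<close> vec.subspace_0[OF N(1)] by auto
  then obtain f where f: "f \<in> N" "f \<noteq> 0"
    and min: "\<And>g. g \<in> N \<Longrightarrow> g \<noteq> 0 \<Longrightarrow> card (block_support \<eta> r f) \<le> card (block_support \<eta> r g)"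
    using ex_has_least_nat[of "\<lambda>f. f \<in> N \<and> f \<noteq> 0" f0 "\<lambda>f. card (block_support \<eta> r f)"] by auto
  obtain i where i: "f $ i \<noteq> 0" using f(2) by (auto simp: vec_eq_iff)
  obtain k where k: "k \<in> {1..r}" "i \<in> block \<eta> k" by (rule exists_block[OF r])
  \<comment> \<open>\<open>j\<close> depends on \<open>f\<close> alone, so the same diagonal
    position gives the eigenvalue for every \<open>M \<in> G\<close>.\<close>
  define j where "j = Max {i \<in> block \<eta> k. f $ i \<noteq> 0}"
  have "j \<in> {i \<in> block \<eta> k. f $ i \<noteq> 0}"
    unfolding j_def using i k by (intro Max_in) auto
  then have j: "j \<in> block \<eta> k" "f $ j \<noteq> 0" by auto
  have max: "i \<le> j" if "i \<in> block \<eta> k" "f $ i \<noteq> 0" for i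
    unfolding j_def using that by (intro Max_ge) auto
  have "f v* M = (M $ j $ j) *s f" if M: "M \<in> G" for M
  proof (rule ccontr)
    let ?h = "f v* M - (M $ j $ j) *s f"
    assume "f v* M \<noteq> (M $ j $ j) *s f"
    then have "?h \<noteq> 0" by simp
    moreover have "?h \<in> N"
      using N f M by (intro vec.subspace_diff vec.subspace_scale) auto
    ultimately have "card (block_support \<eta> r f) \<le> card (block_support \<eta> r ?h)" by (rule min[rotated])
    moreover have "block_support \<eta> r ?h \<subset> block_support \<eta> r f"
      using M G by (intro block_support_eigen_defect[OF r _ k(1) j max]) auto
    ultimately show False
      by (meson finite psubset_card_mono not_le)
  qed
  with f k(1) j(1) show ?thesis by (rule that)
qed

section \<open>Cyclicity under the commutant\<close>

lemma subspace_commutant_image: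
  fixes u :: "complex ^ 'n"
  shows "vec.subspace {T *v u | T. \<forall>M\<in>G. T ** M = M ** T}" (is "vec.subspace ?W")
proof (rule vec.subspaceI)
  show "0 \<in> ?W" by (intro CollectI exI[of _ 0]) (simp add: matrix_matrix_mult_def vec_eq_iff)
next
  fix x y assume "x \<in> ?W" "y \<in> ?W"
  then obtain S T where ST: "x = S *v u" "y = T *v u"
    "\<forall>M\<in>G. S ** M = M ** S" "\<forall>M\<in>G. T ** M = M ** T"
    unfolding mem_Collect_eq by (elim exE conjE)
  have "(S + T) ** M = M ** (S + T)" if "M \<in> G" for M
  proof -
    have "S *v (M *v z) = M *v (S *v z)" "T *v (M *v z) = M *v (T *v z)" for z
      using ST(3,4) that by (simp_all add: matrix_vector_mul_assoc)
    then show ?thesis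
      by (simp add: matrix_eq matrix_vector_mult_add_rdistrib vec.add
          flip: matrix_vector_mul_assoc)
  qed
  then show "x + y \<in> ?W"
    using ST(1,2) by (intro CollectI exI[of _ "S + T"]) (simp add: matrix_vector_mult_add_rdistrib)
next
  fix c x assume "x \<in> ?W"
  then obtain T where T: "x = T *v u" "\<forall>M\<in>G. T ** M = M ** T"
    unfolding mem_Collect_eq by (elim exE conjE)
  have mat: "mat c *v z = c *s z" for z :: "complex ^ 'n"
    by (simp add: matrix_vector_mult_def mat_def vec_eq_iff if_distrib if_distribR
        sum.delta sum.delta' cong: if_cong)
  have "(mat c ** T) ** M = M ** (mat c ** T)" if "M \<in> G" for M
  proof -
    have "T *v (M *v z) = M *v (T *v z)" for z
      using T(2) that by (simp add: matrix_vector_mul_assoc)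
    then show ?thesis
      by (simp add: matrix_eq mat vec.scale flip: matrix_vector_mul_assoc)
  qed
  then show "c *s x \<in> ?W"
    using T(1) by (intro CollectI exI[of _ "mat c ** T"]) (simp add: mat flip: matrix_vector_mul_assoc)
qed

lemma commutant_cyclic:
  fixes u :: "complex ^ 'n::{finite,linorder}"
  assumes \<eta>: "\<forall>k\<in>{1..r}. \<eta> k \<ge> 1" and r: "(\<Sum>k\<in>{1..r}. \<eta> k) = CARD('n)"
    and G: "G \<subseteq> K_set \<eta> r" and comm: "\<And>M N. M \<in> G \<Longrightarrow> N \<in> G \<Longrightarrow> M ** N = N ** M"
    and u: "u \<in> U_set \<eta> r"
    and J: "\<And>y. \<exists>Ms xs. (\<forall>m. Ms m \<in> G) \<and> xs \<longlonglongrightarrow> u \<and> (\<lambda>m. Ms m *v xs m) \<longlonglongrightarrow> y"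
  shows "{T *v u | T. \<forall>M\<in>G. T ** M = M ** T} = UNIV" (is "?W = UNIV")
proof (rule ccontr)
  assume "?W \<noteq> UNIV"
  obtain f0 where f0: "f0 \<noteq> 0" "\<And>w. w \<in> ?W \<Longrightarrow> dot f0 w = 0"
    using exists_annihilating_form[OF subspace_commutant_image \<open>?W \<noteq> UNIV\<close>] by blast
  define N where "N = {f. \<forall>w\<in>?W. dot f w = 0}"
  have "vec.subspace N"
  proof (rule vec.subspaceI)
    show "0 \<in> N" by (simp add: N_def dot_def)
    show "f + g \<in> N" if "f \<in> N" "g \<in> N" for f g
      using that unfolding N_def dot_def by (auto simp: algebra_simps sum.distrib)
    show "c *s f \<in> N" if "f \<in> N" for c f
      using that unfolding N_def by (auto simp: dot_smult_left)
  qed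
  moreover have "f v* M \<in> N" if f: "f \<in> N" and M: "M \<in> G" for f M
  proof -
    \<comment> \<open>Commutativity of \<open>G\<close> enters here: \<open>M ** T\<close> commutes
      with \<open>G\<close> because both factors do.\<close>
    have "M *v w \<in> ?W" if "w \<in> ?W" for w
    proof -
      from that obtain T where T: "w = T *v u" "\<forall>M\<in>G. T ** M = M ** T"
    unfolding mem_Collect_eq by (elim exE conjE)
      have "\<forall>L\<in>G. (M ** T) ** L = L ** (M ** T)"
        using T(2) comm[OF M] by (metis matrix_mul_assoc)
      then show ?thesis
        using T(1) by (intro CollectI exI[of _ "M ** T"]) (simp add: matrix_vector_mul_assoc)
    qed
    then show ?thesis
      using f unfolding N_def by (auto simp: dot_vector_matrix_mult)
  qed
  moreover have "N \<noteq> {0}" using f0 unfolding N_def by blast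
  ultimately obtain f k j where f: "f \<in> N" "f \<noteq> 0" and k: "k \<in> {1..r}" and j: "j \<in> block \<eta> k"
    and eigen: "\<And>M. M \<in> G \<Longrightarrow> f v* M = (M $ j $ j) *s f"
    using exists_common_eigenform[OF r G] by metis
  \<comment> \<open>The coordinate at \<open>i\<close> has the same eigenvalues as \<open>f\<close>,
    because the diagonal is constant on block \<open>k\<close>; membership of \<open>u\<close> in
    \<open>U_set \<eta> r\<close> makes it nonzero at \<open>u\<close>.\<close>
  obtain i :: 'n where i: "pos i = Suc (\<Sum>l\<in>{1..<k}. \<eta> l)" "i \<in> block \<eta> k"
      "\<And>j. j \<in> block \<eta> k \<Longrightarrow> i \<le> j"
    using exists_block_first[OF \<eta> r k] by blast
  have ui: "u $ i \<noteq> 0" using u k i(1) by (auto simp: U_set_def)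
  have "u \<in> ?W" by (intro CollectI exI[of _ "mat 1"]) simp
  then have fu: "dot f u = 0" using f(1) by (auto simp: N_def)
  have "dot f y = 0" for y
  proof -
    obtain Ms xs where Ms: "\<And>m. Ms m \<in> G" and xs: "xs \<longlonglongrightarrow> u"
      and lim: "(\<lambda>m. Ms m *v xs m) \<longlonglongrightarrow> y" using J[of y] by auto
    have f_xs: "dot f (Ms m *v xs m) = Ms m $ i $ i * dot f (xs m)" for m
      using eigen[OF Ms] K_set_diag[OF _ k j i(2)] Ms G
      by (metis dot_smult_left dot_vector_matrix_mult subsetD)
    have i_xs: "(Ms m *v xs m) $ i = Ms m $ i $ i * xs m $ i" for m
      using Ms G by (intro K_set_first_row[OF r k i(2,3)]) auto
    \<comment> \<open>Cross-multiplication: this product and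
      \<open>dot f (Ms m *v xs m) * xs m $ i\<close> both equal
      \<open>Ms m $ i $ i * xs m $ i * dot f (xs m)\<close>, so their limits agree and no division
      by the eigenforms is involved.\<close>
    have "(\<lambda>m. (Ms m *v xs m) $ i * dot f (xs m)) \<longlonglongrightarrow> y $ i * dot f u"
      by (rule tendsto_mult[OF tendsto_vec_nth[OF lim] tendsto_dot[OF xs]])
    then have "(\<lambda>m. dot f (Ms m *v xs m) * xs m $ i) \<longlonglongrightarrow> y $ i * dot f u"
      by (simp add: f_xs i_xs mult_ac)
    moreover have "(\<lambda>m. dot f (Ms m *v xs m) * xs m $ i) \<longlonglongrightarrow> dot f y * u $ i"
      by (rule tendsto_mult[OF tendsto_dot[OF lim] tendsto_vec_nth[OF xs]])
    ultimately have "y $ i * dot f u = dot f y * u $ i"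
      by (rule LIMSEQ_unique)
    then show ?thesis using fu ui by simp
  qed
  then have "f $ l = 0" for l by (metis dot_axis)
  with f(2) show False by (simp add: vec_eq_iff)
qed

section \<open>Commutativity of the generated semigroup\<close>

lemma mat_power_commute:
  assumes "A ** B = B ** A" shows "A ** mat_power B k = mat_power B k ** A"
proof (induction k)
  case (Suc k)
  then show ?case using assms by simp (metis matrix_mul_assoc)
qed simp

lemma monomial_mat_commute:
  assumes "\<And>j. j \<in> {1..p} \<Longrightarrow> B ** A j = A j ** B"
  shows "B ** monomial_mat A k p = monomial_mat A k p ** B"
  using assms
proof (induction p)
  case (Suc p)
  have "B ** mat_power (A (Suc p)) (k (Suc p)) = mat_power (A (Suc p)) (k (Suc p)) ** B"
    using Suc.prems by (intro mat_power_commute) auto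
  with Suc show ?case by simp (metis matrix_mul_assoc)
qed simp

text \<open>\<open>monomial_mat_commute\<close> serves twice: with a generator as \<open>B\<close>,
  then with a whole monomial as \<open>B\<close>.\<close>

lemma semigroup_gen_commute:
  assumes "\<forall>i\<in>{1..p}. \<forall>j\<in>{1..p}. A i ** A j = A j ** A i"
    and "M \<in> semigroup_gen A p" "N \<in> semigroup_gen A p"
  shows "M ** N = N ** M"
  using assms unfolding semigroup_gen_def
  by clarify (intro monomial_mat_commute monomial_mat_commute[symmetric]; simp)

section \<open>Change of coordinates and conclusion\<close>

theorem theorem1p2:
  fixes A :: "nat \<Rightarrow> complex ^ 'n :: {finite, linorder} ^ 'n :: {finite, linorder}"
    and P :: "complex ^ 'n :: {finite, linorder} ^ 'n :: {finite, linorder}"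
    and p r :: nat
    and \<eta> :: "nat \<Rightarrow> nat"
    and G :: "(complex ^ 'n :: {finite, linorder} ^ 'n :: {finite, linorder}) set"
    and V :: "(complex ^ 'n :: {finite, linorder}) set"
    and v :: "complex ^ 'n :: {finite, linorder}"
  assumes "p \<ge> 1"
    and "\<forall>i\<in>{1..p}. \<forall>j\<in>{1..p}. A i ** A j = A j ** A i"
    and "G = semigroup_gen A p"
    and "invertible P"
    and "r \<in> {1..CARD('n)}"
    and "\<forall>k\<in>{1..r}. \<eta> k \<ge> 1"
    and "(\<Sum>k\<in>{1..r}. \<eta> k) = CARD('n)"
    and "(\<lambda>M. matrix_inv P ** M ** P) ` G \<subseteq> K_set \<eta> r"
    and "V = (\<lambda>x. P *v x) ` U_set \<eta> r"
    and "v \<in> V"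
    and "J_set A p v = UNIV"
  shows "closure (orbit G v) = UNIV"
proof -
  define Q where "Q = matrix_inv P"
  have QP: "Q ** P = mat 1" and PQ: "P ** Q = mat 1"
    using someI_ex[OF \<open>invertible P\<close>[unfolded invertible_def]] by (auto simp: Q_def matrix_inv_def)
  have [simp]: "Q *v (P *v x) = x" "P *v (Q *v x) = x" for x
    by (simp_all add: matrix_vector_mul_assoc QP PQ)
  obtain u where u: "u \<in> U_set \<eta> r" "v = P *v u" using assms(9,10) by auto
  \<comment> \<open>The semigroup in the coordinates that make it block triangular; \<open>u\<close>
    is \<open>v\<close> in these coordinates.\<close>
  define H where "H = (\<lambda>M. Q ** M ** P) ` G"
  have H: "H \<subseteq> K_set \<eta> r" using assms(8) by (simp add: H_def Q_def)
  have conj: "(Q ** M ** P) *v (Q *v x) = Q *v (M *v x)" for M x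
    by (simp add: matrix_vector_mul_assoc[symmetric])
  have comm: "M ** N = N ** M" if MN: "M \<in> H" "N \<in> H" for M N
  proof -
    from MN obtain M' N' where M': "M = Q ** M' ** P" "M' \<in> G" and N': "N = Q ** N' ** P" "N' \<in> G"
      by (auto simp: H_def)
    have conj_mult: "(Q ** X ** P) ** (Q ** Y ** P) = Q ** (X ** Y) ** P" for X Y
      by (metis matrix_mul_assoc PQ matrix_mul_rid)
    have "M' ** N' = N' ** M'"
      using semigroup_gen_commute[OF assms(2)] M' N' assms(3) by blast
    then show ?thesis by (simp add: M' N' conj_mult)
  qed
  have J: "\<exists>Ms xs. (\<forall>m. Ms m \<in> H) \<and> xs \<longlonglongrightarrow> u \<and> (\<lambda>m. Ms m *v xs m) \<longlonglongrightarrow> y" for y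
  proof -
    \<comment> \<open>The target in the original coordinates is \<open>P *v y\<close>, which
      \<open>Q\<close> carries back to \<open>y\<close>.\<close>
    have "P *v y \<in> J_set A p v" using assms(11) by simp
    then obtain xs k where xs: "xs \<longlonglongrightarrow> v"
      and lim: "(\<lambda>m. monomial_mat A (k m) p *v xs m) \<longlonglongrightarrow> P *v y"
      by (auto simp: J_set_def)
    have Q_lim: "(\<lambda>m. Q *v z m) \<longlonglongrightarrow> Q *v a" if "z \<longlonglongrightarrow> a" for z a
      using that by (intro isCont_tendsto_compose[OF matrix_vector_mult_linear_continuous_at])
    have "monomial_mat A (k m) p \<in> G" for m
      using assms(3) by (auto simp: semigroup_gen_def)
    moreover note Q_lim[OF xs] Q_lim[OF lim]
    ultimately show ?thesis
      unfolding H_def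
      by (intro exI[of _ "\<lambda>m. Q ** monomial_mat A (k m) p ** P"] exI[of _ "\<lambda>m. Q *v xs m"])
        (auto simp: conj u(2))
  qed
  note cyclic = commutant_cyclic[OF assms(6,7) H comm u(1) J]
  have "y \<in> closure (orbit G v)" for y
  proof -
    obtain Ms xs where Ms: "\<And>m. Ms m \<in> H" and xs: "xs \<longlonglongrightarrow> u"
      and lim: "(\<lambda>m. Ms m *v xs m) \<longlonglongrightarrow> Q *v y" using J[of "Q *v y"] by auto
    have "(\<lambda>m. Ms m *v u) \<longlonglongrightarrow> Q *v y"
      by (rule commutant_closure[OF cyclic Ms xs lim])
    then have "(\<lambda>m. P *v (Ms m *v u)) \<longlonglongrightarrow> P *v (Q *v y)"
      by (intro isCont_tendsto_compose[OF matrix_vector_mult_linear_continuous_at])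
    \<comment> \<open>With \<open>Ms m = Q ** M ** P\<close> the factor \<open>P ** Q\<close>
      cancels, which leaves \<open>M *v v\<close>.\<close>
    moreover have "P *v (Ms m *v u) \<in> orbit G v" for m
    proof -
      obtain M where "M \<in> G" "Ms m = Q ** M ** P" using Ms[of m] by (auto simp: H_def)
      then show ?thesis
        by (auto simp: orbit_def u(2) matrix_vector_mul_assoc[symmetric])
    qed
    ultimately show ?thesis
      unfolding closure_sequential by (intro exI[of _ "\<lambda>m. P *v (Ms m *v u)"]) simp
  qed
  then show ?thesis by auto
qed

end
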